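(* Let $k\ge 1$ be an odd integer and let $N>0$ be an integer. There is no integer $C$ such that for every integer $n\ge 0$ there exists an integer index $j\ge 0$ (depending on $n$ and $N$) with $$\sum_{i=0}^{2N} P_k^{k-1}(n+i) = C\cdot P_k^{k-1}(j).$$
   Context: For an integer $k\ge 1$, the generalized Pell $(k,k-1)$-numbers $P_k^{k-1}(n)$, $n\ge 0$, are defined by $P_k^{k-1}(0)=P_k^{k-1}(1)=\cdots=P_k^{k-1}(k-1)=0$, $P_k^{k-1}(k)=1$, and $P_k^{k-1}(n)=2P_k^{k-1}(n-1)+P_k^{k-1}(n-k-1)$ for $n\ge k+1$. *)

theory Defs
  imports Main
begin

text \<open>
  \<open>pell k n\<close> is the generalized Pell \<open>(k, k - 1)\<close>-number \<open>P\<^sub>k\<^bsup>k-1\<^esup>(n)\<close>, intended for \<open>k \<ge> 1\<close>.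
  In the last case \<open>n \<ge> k + 1\<close>, so neither subtraction truncates.
\<close>

fun pell :: "nat \<Rightarrow> nat \<Rightarrow> int" where
  "pell k n =
    (if n < k then 0
     else if n = k then 1
     else 2 * pell k (n - 1) + pell k (n - k - 1))"

declare pell.simps [simp del]

end

theory Submission
  imports Defs "HOL-Number_Theory.Cong" "Jordan_Normal_Form.Determinant"
begin

text \<open>
  If such a \<open>C\<close> exists, subtracting the identities for \<open>n\<close> and \<open>n + 1\<close> shows that the sequence has
  the period \<open>2 * N + 1\<close> modulo \<open>C\<close>. For odd \<open>k\<close> the Casoratian of the recurrence changes sign at
  every step, so an odd period forces \<open>1 = -1\<close> modulo \<open>C\<close>, that is, \<open>C\<close> divides 2. Modulo 2 the
  odd terms all have odd indices, which excludes even \<open>C\<close>. Hence \<open>C = 1\<close>; but the sequence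
  at least doubles at each step, so the sum lies strictly between two consecutive terms.
\<close>

lemma pell_less: "n < k \<Longrightarrow> pell k n = 0"
  by (simp add: pell.simps)

lemma pell_self: "pell k k = 1"
  by (simp add: pell.simps)

lemma pell_rec: "pell k (n + k + 1) = 2 * pell k (n + k) + pell k n"
  by (subst pell.simps) simp

lemma pell_nonneg: "0 \<le> pell k n"
proof (induction n rule: less_induct)
  case (less n)
  then show ?case
    by (subst pell.simps) auto
qed

lemma pell_double: "2 * pell k n \<le> pell k (n + 1)"
proof (cases "n < k")
  case True
  then show ?thesis
    using pell_nonneg by (simp add: pell_less)
next
  case False
  then obtain m where "n = m + k"
    by (metis add.commute le_Suc_ex not_less)
  then show ?thesis
    using pell_rec[of k m] pell_nonneg[of k m] by simp
qed

lemma mono_pell: "mono (pell k)"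
  unfolding mono_iff_le_Suc
proof
  fix n
  show "pell k n \<le> pell k (Suc n)"
    using pell_double[of k n] pell_nonneg[of k n] by simp
qed

lemma pell_pos: "k \<le> n \<Longrightarrow> 0 < pell k n"
  using monoD[OF mono_pell, of k n k] by (simp add: pell_self)

text \<open>Adding one more term to a sum already below that term gives less than twice the term,
  which \<open>pell_double\<close> bounds by its successor.\<close>

lemma sum_pell_less:
  assumes "k \<le> n"
  shows "(\<Sum>i = 0..m. pell k (n + i)) < pell k (n + m + 1)"
proof (induction m)
  case 0
  then show ?case
    using pell_double[of k n] pell_pos[OF assms] by simp
next
  case (Suc m)
  then show ?case
    using pell_double[of k "n + m + 1"] by simp
qed

lemma less_sum_pell:
  assumes "k \<le> n" "0 < m"
  shows "pell k (n + m) < (\<Sum>i = 0..m. pell k (n + i))"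
proof -
  obtain l where m: "m = Suc l"
    using assms(2) gr0_implies_Suc by blast
  have "0 < (\<Sum>i = 0..l. pell k (n + i))"
    using assms by (intro sum_pos) (auto intro: pell_pos)
  then show ?thesis
    by (simp add: m)
qed

lemma sum_pell_neq_pell:
  assumes "k \<le> n" "0 < m"
  shows "(\<Sum>i = 0..m. pell k (n + i)) \<noteq> pell k j"
proof
  assume eq: "(\<Sum>i = 0..m. pell k (n + i)) = pell k j"
  show False
  proof (cases "j \<le> n + m")
    case True
    then show False
      using monoD[OF mono_pell, of j "n + m" k] less_sum_pell[OF assms] eq by linarith
  next
    case False
    then show False
      using monoD[OF mono_pell, of "n + m + 1" j k] sum_pell_less[OF assms(1), of m] eq by linarith
  qed
qed

text \<open>Modulo 2 the recurrence only copies the value from \<open>k + 1\<close> places earlier.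
  For odd \<open>k\<close> this shift is even, so the sole odd initial value, at the odd index
  \<open>k\<close>, spreads to odd indices only.\<close>

lemma odd_pell_imp_odd:
  assumes "odd k" "odd (pell k n)"
  shows "odd n"
  using assms(2)
proof (induction n rule: less_induct)
  case (less n)
  consider "n < k" | "n = k" | m where "n = m + k + 1"
    by (metis add.commute add_Suc_right less_iff_Suc_add linorder_neqE_nat Suc_eq_plus1)
  then show ?case
  proof cases
    case 3
    then have "odd (pell k m)"
      using less.prems by (simp only: pell_rec) simp
    then have "odd m"
      using less.IH[of m] 3 by simp
    then show ?thesis
      using 3 assms(1) by simp
  qed (use less.prems assms(1) in \<open>simp_all add: pell_less\<close>)
qed

text \<open>This is the Casorati matrix with its columns in reverse order. The reversal makes the
  matrix at \<open>n = 0\<close> lower triangular with unit diagonal.\<close>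

definition pell_mat :: "nat \<Rightarrow> nat \<Rightarrow> int mat" where
  "pell_mat k n = mat (Suc k) (Suc k) (\<lambda>(i, j). pell k (n + i + (k - j)))"

text \<open>Companion matrix of the recurrence. The two contributions to the last row are added
  because they fall on the same entry when \<open>k = 0\<close>.\<close>

definition pell_companion :: "nat \<Rightarrow> int mat" where
  "pell_companion k = mat (Suc k) (Suc k) (\<lambda>(i, j).
     if i < k then (if j = Suc i then 1 else 0)
     else (if j = 0 then 1 else 0) + (if j = k then 2 else 0))"

lemma pell_mat_carrier: "pell_mat k n \<in> carrier_mat (Suc k) (Suc k)"
  by (simp add: pell_mat_def)

lemma pell_companion_carrier: "pell_companion k \<in> carrier_mat (Suc k) (Suc k)"
  by (simp add: pell_companion_def)

text \<open>The first \<open>k\<close> rows of the companion matrix shift the rows up by one, and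
  its last row applies the recurrence.\<close>

lemma pell_mat_Suc: "pell_mat k (Suc n) = pell_companion k * pell_mat k n"
proof (rule eq_matI)
  fix i j
  assume "i < dim_row (pell_companion k * pell_mat k n)"
    and "j < dim_col (pell_companion k * pell_mat k n)"
  then have ij: "i < Suc k" "j < Suc k"
    by (simp_all add: pell_companion_def pell_mat_def)
  let ?p = "\<lambda>l. pell k (n + l + (k - j))"
  have "(pell_companion k * pell_mat k n) $$ (i, j) =
      (\<Sum>l = 0..<Suc k. pell_companion k $$ (i, l) * ?p l)"
    using ij by (simp add: pell_mat_def pell_companion_def scalar_prod_def del: sum.op_ivl_Suc)
  also have "\<dots> = ?p (Suc i)"
  proof (cases "i < k")
    case True
    then have "(\<Sum>l = 0..<Suc k. pell_companion k $$ (i, l) * ?p l) =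
        (\<Sum>l = 0..<Suc k. if l = Suc i then ?p l else 0)"
      by (intro sum.cong) (simp_all add: pell_companion_def)
    then show ?thesis
      using True by (simp del: sum.op_ivl_Suc)
  next
    case False
    then have "i = k"
      using ij by simp
    then have "(\<Sum>l = 0..<Suc k. pell_companion k $$ (i, l) * ?p l) =
        (\<Sum>l = 0..<Suc k. (if l = 0 then ?p l else 0) + (if l = k then 2 * ?p l else 0))"
      by (intro sum.cong) (auto simp: pell_companion_def)
    also have "\<dots> = ?p 0 + 2 * ?p k"
      by (simp add: sum.distrib del: sum.op_ivl_Suc)
    also have "\<dots> = ?p (Suc i)"
      using pell_rec[of k "n + (k - j)"] \<open>i = k\<close> by (simp add: ac_simps)
    finally show ?thesis .
  qed
  finally show "pell_mat k (Suc n) $$ (i, j) = (pell_companion k * pell_mat k n) $$ (i, j)"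
    using ij by (simp add: pell_mat_def)
qed (simp_all add: pell_mat_def pell_companion_def)

lemma det_pell_companion:
  assumes "0 < k"
  shows "det (pell_companion k) = (- 1) ^ k"
proof -
  let ?A = "pell_companion k"
  \<comment> \<open>Column 0 has its only nonzero entry in row \<open>k\<close>, so this minor alone
    survives the expansion.\<close>
  have minor: "mat_delete ?A k 0 = 1\<^sub>m k"
    by (rule eq_matI) (auto simp: mat_delete_def pell_companion_def)
  have "det ?A = (\<Sum>i<Suc k. ?A $$ (i, 0) * cofactor ?A i 0)"
    by (rule laplace_expansion_column[OF pell_companion_carrier]) simp
  also have "\<dots> = (\<Sum>i<Suc k. if i = k then cofactor ?A k 0 else 0)"
    using assms by (intro sum.cong) (auto simp: pell_companion_def)
  also have "\<dots> = cofactor ?A k 0"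
    by simp
  also have "\<dots> = (- 1) ^ k"
    by (simp add: cofactor_def minor)
  finally show ?thesis .
qed

lemma det_pell_mat:
  assumes "0 < k"
  shows "det (pell_mat k n) = (- 1) ^ (k * n)"
proof (induction n)
  case 0
  have "det (pell_mat k 0) = prod_list (diag_mat (pell_mat k 0))"
    by (rule det_lower_triangular[OF _ pell_mat_carrier]) (auto simp: pell_mat_def pell_less)
  also have "diag_mat (pell_mat k 0) = map (\<lambda>_. 1) [0..<Suc k]"
    unfolding diag_mat_def by (rule map_cong) (auto simp: pell_mat_def pell_self)
  finally show ?case
    by (simp add: map_replicate_const)
next
  case (Suc n)
  then show ?case
    using assms
    by (simp add: pell_mat_Suc det_mult[OF pell_companion_carrier pell_mat_carrier]
        det_pell_companion power_add)
qed

text \<open>By the Leibniz formula the determinant is an integer polynomial in the entries.\<close>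

lemma cong_det:
  fixes A B :: "int mat"
  assumes "A \<in> carrier_mat n n" "B \<in> carrier_mat n n"
    and "\<And>i j. i < n \<Longrightarrow> j < n \<Longrightarrow> [A $$ (i, j) = B $$ (i, j)] (mod c)"
  shows "[det A = det B] (mod c)"
  unfolding det_def'[OF assms(1)] det_def'[OF assms(2)]
  by (intro cong_sum cong_mult cong_refl cong_prod assms(3)) (auto simp: permutes_in_image)

lemma pell_odd_period_dvd_two:
  assumes "odd k" "odd p" "\<And>n. [pell k (n + p) = pell k n] (mod c)"
  shows "c dvd 2"
proof -
  have k: "0 < k"
    using assms(1) by (rule odd_pos)
  have "[det (pell_mat k p) = det (pell_mat k 0)] (mod c)"
  proof (rule cong_det[OF pell_mat_carrier pell_mat_carrier])
    fix i j
    assume "i < Suc k" "j < Suc k"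
    then show "[pell_mat k p $$ (i, j) = pell_mat k 0 $$ (i, j)] (mod c)"
      using assms(3)[of "i + (k - j)"] by (simp add: pell_mat_def ac_simps)
  qed
  \<comment> \<open>The exponent \<open>k * p\<close> is odd, while at \<open>n = 0\<close> the
    exponent vanishes.\<close>
  then have "[- 1 = 1] (mod c)"
    using assms(1,2) by (simp add: det_pell_mat[OF k])
  then show ?thesis
    by (simp add: cong_iff_dvd_diff)
qed

theorem theorem7p5:
  fixes k N :: nat
  assumes "k \<ge> 1" and "odd k" and "N > 0"
  shows "\<not> (\<exists>C::int. \<forall>n::nat. \<exists>j::nat. (\<Sum>i = 0..2 * N. pell k (n + i)) = C * pell k j)"
proof
  assume "\<exists>C::int. \<forall>n::nat. \<exists>j::nat. (\<Sum>i = 0..2 * N. pell k (n + i)) = C * pell k j"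
  then obtain C :: int where
    C: "\<And>n. \<exists>j. (\<Sum>i = 0..2 * N. pell k (n + i)) = C * pell k j"
    by blast
  let ?p = "2 * N + 1"
  have dvd_sum: "C dvd (\<Sum>i = 0..2 * N. pell k (n + i))" for n
    using C[of n] by auto
  \<comment> \<open>The difference of consecutive window sums telescopes to its two end
    terms.\<close>
  have period: "[pell k (n + ?p) = pell k n] (mod C)" for n
  proof -
    have "(\<Sum>i = 0..2 * N. pell k (Suc n + i)) - (\<Sum>i = 0..2 * N. pell k (n + i)) =
        (\<Sum>i = 0..2 * N. pell k (n + Suc i) - pell k (n + i))"
      by (simp add: sum_subtractf)
    also have "\<dots> = pell k (n + ?p) - pell k n"
      using sum_Suc_diff[of 0 "2 * N" "\<lambda>i. pell k (n + i)"] by simp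
    finally show ?thesis
      using dvd_sum[of n] dvd_sum[of "Suc n"] by (metis cong_iff_dvd_diff dvd_diff)
  qed
  have "\<bar>C\<bar> \<le> 2"
    using dvd_imp_le_int[of 2 C] pell_odd_period_dvd_two[OF assms(2) _ period] by simp
  moreover have "\<not> 2 dvd C"
  proof
    assume "2 dvd C"
    then have "even (pell k (k + ?p) - pell k k)"
      using period[of k] dvd_trans unfolding cong_iff_dvd_diff by blast
    \<comment> \<open>The index \<open>k + ?p\<close> is even, being a sum of two odd numbers, so an
      odd term there is impossible.\<close>
    then have "odd (pell k (k + ?p))"
      by (simp add: pell_self)
    then show False
      using odd_pell_imp_odd[OF assms(2)] assms(2) by fastforce
  qed
  \<comment> \<open>Oddness discards 0 and both signs of 2.\<close>
  ultimately have "\<bar>C\<bar> = 1"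
    by presburger
  \<comment> \<open>At \<open>n = k\<close> all summands are positive, which rules out
    \<open>C = -1\<close> and lets the strict bounds apply.\<close>
  obtain j where j: "(\<Sum>i = 0..2 * N. pell k (k + i)) = C * pell k j"
    using C by blast
  have "0 < (\<Sum>i = 0..2 * N. pell k (k + i))"
    by (intro sum_pos) (auto intro: pell_pos)
  then have "C = 1"
    using j \<open>\<bar>C\<bar> = 1\<close> pell_nonneg[of k j] by (auto simp: abs_if split: if_splits)
  then show False
    using j sum_pell_neq_pell[of k k "2 * N" j] assms(3) by simp
qed

end
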